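(* Let $\mathbb{F}_q$ be a finite field, let $w_0,w_1$ be positive integers, and let $d$ be an element of the semigroup $\langle w_0,w_1\rangle_{\mathbb{N}}=\{w_0i_0+w_1i_1: i_0,i_1\in\mathbb{Z}_{\geq 0}\}$. Write the Euclidean division of $d$ by $\operatorname{lcm}(w_0,w_1)$ as $d=\lambda\operatorname{lcm}(w_0,w_1)+\rho$ with $0\leq\rho<\operatorname{lcm}(w_0,w_1)$. Then $e_q(d;w_0,w_1)=\min\{q+1,\,E\}$, where \[ E=\begin{cases} \lambda & \text{if } \operatorname{lcm}(w_0,w_1)\mid d,\\ \lambda+1 & \text{if exactly one of } w_0,w_1 \text{ divides } d,\\ \lambda+1+\operatorname{den}(\rho;w_0,w_1) & \text{if } w_0\nmid d \text{ and } w_1\nmid d. \end{cases} \]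
   Context: The weighted projective line $\mathbb{P}(w_0,w_1)$ is the quotient of $\overline{\mathbb{F}_q}^{\,2}\setminus\{0\}$ by the action of $\overline{\mathbb{F}_q}^*$ given by $\lambda\cdot(x_0,x_1)=(\lambda^{w_0}x_0,\lambda^{w_1}x_1)$; $\mathbb{P}(w_0,w_1)(\mathbb{F}_q)$ is the set of its points invariant under the Frobenius $(x_0,x_1)\mapsto(x_0^q,x_1^q)$. $\mathbb{F}_q[x_0,x_1]^w_d$ is the $\mathbb{F}_q$-span of the monomials $x_0^{a_0}x_1^{a_1}$ with $w_0a_0+w_1a_1=d$, and $V_{\mathbb{P}(w_0,w_1)}(f)(\mathbb{F}_q)$ is the set of points of $\mathbb{P}(w_0,w_1)(\mathbb{F}_q)$ at which $f$ vanishes. Define \[e_q(d;w_0,w_1):=\max\{|V_{\mathbb{P}(w_0,w_1)}(f)(\mathbb{F}_q)| : f\in\mathbb{F}_q[x_0,x_1]^w_d,\ f\neq0\}.\] The denumerant is $\operatorname{den}(n;w_0,w_1):=|\{(i_0,i_1)\in\mathbb{Z}_{\geq0}^2 : w_0i_0+w_1i_1=n\}|$. *)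

theory Defs
  imports
    "HOL-Algebra.Algebraic_Closure_Type"
    "HOL-Library.Cardinality"
    "HOL-Library.FuncSet"
    "HOL-Library.Poly_Mapping"
    "HOL-Library.Product_Plus"
begin

text \<open>
  The finite field \<open>F\<^sub>q\<close> is a type \<open>'a\<close> of class \<open>{field, finite}\<close>, so that \<open>q = CARD('a)\<close>; its
  algebraic closure is \<open>'a alg_closure\<close>, with embedding \<open>to_ac\<close>. A point of the weighted projective
  line is an orbit of the action, as a set of pairs.
\<close>

definition punctured_plane :: "('k :: field \<times> 'k) set" where
  "punctured_plane = UNIV - {(0, 0)}"

definition wscale :: "nat \<Rightarrow> nat \<Rightarrow> 'k :: field \<Rightarrow> 'k \<times> 'k \<Rightarrow> 'k \<times> 'k" where
  "wscale w0 w1 l x = (l ^ w0 * fst x, l ^ w1 * snd x)"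

definition wproj_rel :: "nat \<Rightarrow> nat \<Rightarrow> (('k :: field \<times> 'k) \<times> ('k \<times> 'k)) set" where
  "wproj_rel w0 w1 =
     {(x, y). x \<in> punctured_plane \<and> y \<in> punctured_plane \<and> (\<exists>l. l \<noteq> 0 \<and> y = wscale w0 w1 l x)}"

definition wproj_line :: "nat \<Rightarrow> nat \<Rightarrow> ('a :: field alg_closure \<times> 'a alg_closure) set set" where
  "wproj_line w0 w1 = punctured_plane // wproj_rel w0 w1"

definition frob :: "'a :: {field, finite} alg_closure \<times> 'a alg_closure \<Rightarrow>
    'a alg_closure \<times> 'a alg_closure" where
  "frob x = (fst x ^ CARD('a), snd x ^ CARD('a))"

definition wproj_rational_points ::
    "nat \<Rightarrow> nat \<Rightarrow> ('a :: {field, finite} alg_closure \<times> 'a alg_closure) set set" where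
  "wproj_rational_points w0 w1 = {P \<in> wproj_line w0 w1. frob ` P = P}"

lemma equiv_wproj_rel: "equiv (punctured_plane :: ('a :: field \<times> 'a) set) (wproj_rel w0 w1)"
proof (rule equivI)
  show "wproj_rel w0 w1 \<subseteq> punctured_plane \<times> punctured_plane"
    by (auto simp: wproj_rel_def)
  show "refl_on punctured_plane (wproj_rel w0 w1)"
    by (auto simp: refl_on_def wproj_rel_def wscale_def intro!: exI[of _ 1])
  show "sym (wproj_rel w0 w1 :: (('a \<times> 'a) \<times> _) set)"
  proof (rule symI)
    fix x y :: "'a \<times> 'a"
    assume "(x, y) \<in> wproj_rel w0 w1"
    then obtain l where *: "l \<noteq> 0" "y = wscale w0 w1 l x"
        "x \<in> punctured_plane" "y \<in> punctured_plane"
      by (auto simp: wproj_rel_def)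
    hence "x = wscale w0 w1 (inverse l) y" by (simp add: wscale_def prod_eq_iff field_simps)
    moreover have "inverse l \<noteq> 0" using * by simp
    ultimately show "(y, x) \<in> wproj_rel w0 w1" using * unfolding wproj_rel_def by blast
  qed
  show "trans (wproj_rel w0 w1 :: (('a \<times> 'a) \<times> _) set)"
  proof (rule transI)
    fix x y z :: "'a \<times> 'a"
    assume "(x, y) \<in> wproj_rel w0 w1" "(y, z) \<in> wproj_rel w0 w1"
    then obtain l m where *: "l \<noteq> 0" "m \<noteq> 0" "y = wscale w0 w1 l x" "z = wscale w0 w1 m y"
        "x \<in> punctured_plane" "z \<in> punctured_plane"
      by (auto simp: wproj_rel_def)
    hence "z = wscale w0 w1 (m * l) x" by (simp add: wscale_def power_mult_distrib)
    moreover have "m * l \<noteq> 0" using * by simp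
    ultimately show "(x, z) \<in> wproj_rel w0 w1" using * unfolding wproj_rel_def by blast
  qed
qed

text \<open>
  The set image of the orbit of \<open>x\<close> under the Frobenius is the whole orbit of \<open>frob x\<close>. So
  \<open>frob ` P\<close> is the image of \<open>P\<close> under the map that the Frobenius induces on the quotient.
\<close>

lemma frob_image_orbit:
  fixes x :: "'a :: {field, finite} alg_closure \<times> 'a alg_closure"
  assumes "x \<in> punctured_plane"
  shows "frob ` (wproj_rel w0 w1 `` {x}) = wproj_rel w0 w1 `` {frob x}"
proof -
  have q: "CARD('a) > 0" by simp
  have orbit: "wproj_rel w0 w1 `` {y} = (\<lambda>l. wscale w0 w1 l y) ` {l. l \<noteq> 0}"
    if "y \<in> punctured_plane" for y :: "'a alg_closure \<times> 'a alg_closure"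
    using that by (auto simp: wproj_rel_def punctured_plane_def wscale_def prod_eq_iff)
  have fx: "frob x \<in> punctured_plane"
    using assms q by (auto simp: punctured_plane_def frob_def prod_eq_iff)
  have comm: "frob (wscale w0 w1 l x) = wscale w0 w1 (l ^ CARD('a)) (frob x)" for l
    by (simp add: frob_def wscale_def power_mult_distrib power_mult [symmetric] mult.commute)
  have "\<exists>l. l \<noteq> 0 \<and> l ^ CARD('a) = m" if "m \<noteq> 0" for m :: "'a alg_closure"
    using nth_root_exists[OF q, of m] that q by (metis power_0_left neq0_conv)
  hence surj: "(\<lambda>l. l ^ CARD('a)) ` {l. l \<noteq> 0} = {m :: 'a alg_closure. m \<noteq> 0}"
    by (force simp: image_iff)
  have "frob ` (wproj_rel w0 w1 `` {x}) =
      (\<lambda>m. wscale w0 w1 m (frob x)) ` (\<lambda>l. l ^ CARD('a)) ` {l. l \<noteq> 0}"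
    unfolding orbit[OF assms]
    by (simp only: image_image comm)
  also have "\<dots> = wproj_rel w0 w1 `` {frob x}"
    unfolding surj orbit[OF fx] ..
  finally show ?thesis .
qed

text \<open>
  The polynomial ring in \<open>x\<^sub>0\<close>, \<open>x\<^sub>1\<close> over \<open>'a\<close> is \<open>nat \<times> nat \<Rightarrow>\<^sub>0 'a\<close>, the monoid algebra of
  pairs of exponents: \<open>Poly_Mapping.single (a0, a1) c\<close> is the term \<open>c x\<^sub>0^a0 x\<^sub>1^a1\<close>.
\<close>

abbreviation poly_scale :: "'a :: field \<Rightarrow> (nat \<times> nat \<Rightarrow>\<^sub>0 'a) \<Rightarrow> (nat \<times> nat \<Rightarrow>\<^sub>0 'a)" where
  "poly_scale c f \<equiv> Poly_Mapping.map ((*) c) f"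

lemma lookup_poly_scale: "Poly_Mapping.lookup (poly_scale c f) m = c * Poly_Mapping.lookup f m"
  by (simp add: Poly_Mapping.map.rep_eq when_def)

global_interpretation poly_space: vector_space "poly_scale :: 'a :: field \<Rightarrow> _"
  by standard (auto intro!: poly_mapping_eqI simp: lookup_poly_scale lookup_add algebra_simps)

definition wpoly :: "nat \<Rightarrow> nat \<Rightarrow> nat \<Rightarrow> (nat \<times> nat \<Rightarrow>\<^sub>0 'a :: field) set" where
  "wpoly w0 w1 d =
     poly_space.span {Poly_Mapping.single (a0, a1) 1 | a0 a1. w0 * a0 + w1 * a1 = d}"

definition eval2 :: "(nat \<times> nat \<Rightarrow>\<^sub>0 'a :: field) \<Rightarrow> 'a alg_closure \<times> 'a alg_closure \<Rightarrow> 'a alg_closure"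
where
  "eval2 f x =
     (\<Sum>m\<in>Poly_Mapping.keys f. to_ac (Poly_Mapping.lookup f m) * fst x ^ fst m * snd x ^ snd m)"

lemma keys_wpoly:
  fixes f :: "nat \<times> nat \<Rightarrow>\<^sub>0 'a :: field"
  assumes "f \<in> wpoly w0 w1 d" "m \<in> Poly_Mapping.keys f"
  shows "w0 * fst m + w1 * snd m = d"
proof -
  have "\<forall>m. Poly_Mapping.lookup f m \<noteq> 0 \<longrightarrow> w0 * fst m + w1 * snd m = d"
    using assms(1) unfolding wpoly_def
  proof (induction rule: poly_space.span_induct_alt)
    case base
    then show ?case by simp
  next
    case (step c x y)
    then obtain a0 a1 where *: "x = Poly_Mapping.single (a0, a1) 1" "w0 * a0 + w1 * a1 = d"
      by auto
    show ?case
    proof (intro allI impI)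
      fix m assume "Poly_Mapping.lookup (poly_scale c x + y) m \<noteq> 0"
      hence "m = (a0, a1) \<or> Poly_Mapping.lookup y m \<noteq> 0"
        by (auto simp: lookup_add lookup_poly_scale *(1) lookup_single when_def split: if_splits)
      thus "w0 * fst m + w1 * snd m = d" using step *(2) by auto
    qed
  qed
  thus ?thesis using assms(2) by (auto simp: in_keys_iff)
qed

lemma eval2_wscale:
  fixes f :: "nat \<times> nat \<Rightarrow>\<^sub>0 'a :: field"
  assumes "f \<in> wpoly w0 w1 d"
  shows "eval2 f (wscale w0 w1 l x) = l ^ d * eval2 f x"
proof -
  have "to_ac (Poly_Mapping.lookup f m) * fst (wscale w0 w1 l x) ^ fst m *
          snd (wscale w0 w1 l x) ^ snd m =
        l ^ d * (to_ac (Poly_Mapping.lookup f m) * fst x ^ fst m * snd x ^ snd m)"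
    if "m \<in> Poly_Mapping.keys f" for m
    unfolding keys_wpoly[OF assms that, symmetric]
    by (simp add: wscale_def power_mult_distrib power_add power_mult)
  thus ?thesis unfolding eval2_def sum_distrib_left by (intro sum.cong) (simp_all only:)
qed

text \<open>
  For weighted homogeneous \<open>f\<close>, vanishing does not depend on the representative, so \<open>f\<close> vanishes
  at \<open>P\<close> iff it does at all representatives of \<open>P\<close>.
\<close>

definition wzeros :: "nat \<Rightarrow> nat \<Rightarrow> (nat \<times> nat \<Rightarrow>\<^sub>0 'a :: {field, finite}) \<Rightarrow>
    ('a alg_closure \<times> 'a alg_closure) set set" where
  "wzeros w0 w1 f = {P \<in> wproj_rational_points w0 w1. \<forall>x\<in>P. eval2 f x = 0}"

text \<open>
  The type argument selects the finite field. The set whose maximum is taken is finite and nonempty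
  for positive weights and \<open>d\<close> in the semigroup they generate: see the lemmas \<open>finite_wpoly\<close> and
  \<open>wpoly_nonzero\<close>.
\<close>

definition max_wzeros :: "'a :: {field, finite} itself \<Rightarrow> nat \<Rightarrow> nat \<Rightarrow> nat \<Rightarrow> nat" where
  "max_wzeros _ d w0 w1 =
     Max {card (wzeros w0 w1 f) | f :: nat \<times> nat \<Rightarrow>\<^sub>0 'a. f \<in> wpoly w0 w1 d \<and> f \<noteq> 0}"

lemma finite_wpoly:
  assumes "w0 > 0" "w1 > 0"
  shows "finite (wpoly w0 w1 d :: (nat \<times> nat \<Rightarrow>\<^sub>0 'a :: {field, finite}) set)"
proof -
  define S where
    "S = {Poly_Mapping.single (a0, a1) (1 :: 'a) | a0 a1. w0 * a0 + w1 * a1 = d}"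
  have "S \<subseteq> (\<lambda>m. Poly_Mapping.single m 1) ` ({..d} \<times> {..d})"
  proof
    fix f assume "f \<in> S"
    then obtain a0 a1 where *: "f = Poly_Mapping.single (a0, a1) 1" "w0 * a0 + w1 * a1 = d"
      by (auto simp: S_def)
    have "a0 \<le> w0 * a0" "a1 \<le> w1 * a1" using assms by auto
    hence "a0 \<le> d" "a1 \<le> d" using *(2) by linarith+
    thus "f \<in> (\<lambda>m. Poly_Mapping.single m 1) ` ({..d} \<times> {..d})" using *(1) by auto
  qed
  hence S: "finite S" by (rule finite_subset) auto
  have "poly_space.span S \<subseteq> (\<lambda>u. \<Sum>v\<in>S. poly_scale (u v) v) ` (S \<rightarrow>\<^sub>E UNIV)"
  proof
    fix f assume "f \<in> poly_space.span S"
    then obtain u where "f = (\<Sum>v\<in>S. poly_scale (u v) v)"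
      unfolding poly_space.span_finite[OF S] by auto
    hence "f = (\<Sum>v\<in>S. poly_scale (restrict u S v) v)" by simp
    thus "f \<in> (\<lambda>u. \<Sum>v\<in>S. poly_scale (u v) v) ` (S \<rightarrow>\<^sub>E UNIV)"
      by (intro image_eqI[where x = "restrict u S"]) auto
  qed
  moreover have "finite (S \<rightarrow>\<^sub>E (UNIV :: 'a set))" using S by (intro finite_PiE) auto
  ultimately show ?thesis unfolding wpoly_def S_def[symmetric]
    by (rule finite_subset[OF _ finite_imageI])
qed

definition num_semigroup :: "nat \<Rightarrow> nat \<Rightarrow> nat set" where
  "num_semigroup w0 w1 = {w0 * i0 + w1 * i1 | i0 i1. True}"

lemma wpoly_nonzero:
  assumes "d \<in> num_semigroup w0 w1"
  shows "\<exists>f :: nat \<times> nat \<Rightarrow>\<^sub>0 'a :: field. f \<in> wpoly w0 w1 d \<and> f \<noteq> 0"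
proof -
  obtain i0 i1 where "d = w0 * i0 + w1 * i1" using assms by (auto simp: num_semigroup_def)
  hence "Poly_Mapping.single (i0, i1) (1 :: 'a) \<in> wpoly w0 w1 d"
    unfolding wpoly_def by (intro poly_space.span_base) auto
  moreover have "Poly_Mapping.single (i0, i1) (1 :: 'a) \<noteq> 0"
    by (metis lookup_single_eq lookup_zero zero_neq_one)
  ultimately show ?thesis by blast
qed

definition den :: "nat \<Rightarrow> nat \<Rightarrow> nat \<Rightarrow> nat" where
  "den n w0 w1 = card {(i0, i1). w0 * i0 + w1 * i1 = n}"

end

(*
  Let g = gcd(w0, w1), w0 = g u0, w1 = g u1. The orbit invariant x1^u0 / x0^u1 identifies the
  rational points of the weighted projective line with the projective line over F_q. Dividing
  exponents with remainder gives d = w0 s + w1 r + N lcm(w0, w1) with s < u1 and r < u0, and a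
  polynomial of degree d is x0^s x1^r times a binary form of degree N in x0^u1, x1^u0. Its zeros are those of
  the form together with the point x0 = 0 if s > 0 and the point x1 = 0 if r > 0. The form has at
  most N zeros, which can be placed anywhere, so the maximum is min(q + 1, N + [s > 0] + [r > 0]).
  Finally r = 0 iff w0 divides d, s = 0 iff w1 divides d, and if both are positive, then
  N + 1 = lam + den(rho), the case den(rho) = 0 being the one where w0 s + w1 r exceeds the lcm.
*)

theory Submission
  imports Defs "HOL-Number_Theory.Cong"
begin

section \<open>Elements of a finite field inside its algebraic closure\<close>

lemma power_CARD_eq_self:
  fixes x :: "'a :: {field, finite}"
  shows "x ^ CARD('a) = x"
proof (cases "x = 0")
  case False
  define P where "P = (\<Prod>y\<in>UNIV - {0 :: 'a}. y)"
  \<comment> \<open>Multiplication by a nonzero \<open>x\<close> permutes the nonzero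
    elements.\<close>
  have "P = (\<Prod>y\<in>UNIV - {0}. x * y)"
    unfolding P_def
    by (rule prod.reindex_bij_witness[of _ "\<lambda>y. x * y" "\<lambda>y. y / x"]) (use False in auto)
  also have "\<dots> = x ^ (CARD('a) - 1) * P"
    by (simp add: prod.distrib P_def card_Diff_singleton)
  finally have "x ^ (CARD('a) - 1) = 1"
    by (simp add: P_def)
  moreover have "CARD('a) = Suc (CARD('a) - 1)" by simp
  ultimately show ?thesis by (metis mult.right_neutral power_Suc)
qed simp

text \<open>The polynomial \<open>X^q - X\<close> has at most \<open>q\<close> roots in the closure,
  and the \<open>q\<close> embedded field elements are already roots.\<close>

lemma range_to_ac_iff:
  fixes z :: "'a :: {field, finite} alg_closure"
  shows "z \<in> range to_ac \<longleftrightarrow> z ^ CARD('a) = z"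
proof -
  define q where "q = CARD('a)"
  have q: "q \<ge> 2"
    unfolding q_def using card_mono[of UNIV "{0 :: 'a, 1}"] by simp
  define p where "p = Polynomial.monom (1 :: 'a alg_closure) q - [:0, 1:]"
  have deg: "degree p = q"
    unfolding p_def using q
    by (simp add: diff_conv_add_uminus degree_add_eq_left degree_monom_eq del: add_uminus_conv_diff)
  hence "p \<noteq> 0" using q by auto
  have roots: "{z. poly p z = 0} = {z. z ^ q = z}"
    by (auto simp: p_def poly_monom)
  have "range (to_ac :: 'a \<Rightarrow> _) = {z. z ^ q = z}"
  proof (rule card_seteq)
    show "finite {z :: 'a alg_closure. z ^ q = z}"
      using poly_roots_finite[OF \<open>p \<noteq> 0\<close>] by (simp add: roots)
    show "range (to_ac :: 'a \<Rightarrow> _) \<subseteq> {z. z ^ q = z}"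
      by (auto simp: q_def power_CARD_eq_self simp flip: to_ac_power)
    show "card {z :: 'a alg_closure. z ^ q = z} \<le> card (range (to_ac :: 'a \<Rightarrow> _))"
      using card_poly_roots_bound[OF \<open>p \<noteq> 0\<close>]
      by (simp add: roots deg card_image[OF inj_to_ac] q_def)
  qed
  thus ?thesis by (auto simp: q_def)
qed

lemma eval2_superset:
  assumes "finite S" "Poly_Mapping.keys f \<subseteq> S"
  shows "eval2 f x =
    (\<Sum>m\<in>S. to_ac (Poly_Mapping.lookup f m) * fst x ^ fst m * snd x ^ snd m)"
  unfolding eval2_def using assms
  by (intro sum.mono_neutral_left) (auto simp: in_keys_iff)

section \<open>Monomials of weighted degree \<open>d\<close> and dehomogenisation\<close>

locale weighted_degree =
  fixes g u0 u1 s r N :: nat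
  assumes g: "g > 0" and u0: "u0 > 0" and u1: "u1 > 0" and coprime: "coprime u0 u1"
    and s: "s < u1" and r: "r < u0"
begin

abbreviation "w0 \<equiv> g * u0"
abbreviation "w1 \<equiv> g * u1"
abbreviation "d \<equiv> w0 * s + w1 * r + N * (g * u0 * u1)"

text \<open>The exponents of \<open>x0^s x1^r (x0^u1)^(N-j) (x1^u0)^j\<close>. Subtraction
  truncates, so only \<open>j \<le> N\<close> is meaningful.\<close>

definition exps :: "nat \<Rightarrow> nat \<times> nat" where
  "exps j = (s + (N - j) * u1, r + j * u0)"

lemma inj_exps: "inj exps"
  using u0 by (auto simp: inj_on_def exps_def)

text \<open>After cancelling \<open>g\<close>, reduction modulo \<open>u0\<close> fixes
  \<open>b\<close> up to multiples of \<open>u0\<close>, because \<open>u1\<close> is a unit there.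
  Then \<open>b\<close> determines \<open>a\<close>.\<close>

lemma weighted_degree_eq_iff: "w0 * a + w1 * b = d \<longleftrightarrow> (\<exists>j\<le>N. (a, b) = exps j)"
proof
  assume "w0 * a + w1 * b = d"
  hence "g * (u0 * a + u1 * b) = g * (u0 * s + u1 * r + N * u0 * u1)"
    by (simp add: algebra_simps)
  hence eq: "u0 * a + u1 * b = u0 * s + u1 * r + N * u0 * u1"
    using g by simp
  have "[u1 * b = u1 * r] (mod u0)"
  proof -
    have "(u0 * a + u1 * b) mod u0 = (u1 * r + u0 * (s + N * u1)) mod u0"
      unfolding eq by (simp add: algebra_simps)
    thus ?thesis by (simp add: cong_def)
  qed
  hence "[b = r] (mod u0)"
    using coprime by (simp add: cong_mult_lcancel_nat coprime_commute)
  hence b: "b = r + (b div u0) * u0"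
    using r by (simp add: cong_def) (metis add.commute div_mult_mod_eq)
  define j where "j = b div u0"
  have b: "b = r + j * u0" using b by (simp add: j_def)
  have "u0 * (a + j * u1) = u0 * (s + N * u1)"
    using eq by (simp add: b algebra_simps)
  hence a: "a + j * u1 = s + N * u1" using u0 by simp
  \<comment> \<open>Here \<open>a \<ge> 0\<close> and \<open>s < u1\<close> give
    \<open>j * u1 \<le> s + N * u1 < (N + 1) * u1\<close>.\<close>
  have "j * u1 < Suc N * u1" using a s by simp
  hence "j \<le> N" by (simp only: mult_less_cancel2) simp
  moreover from this have "N * u1 = (N - j) * u1 + j * u1"
    by (simp flip: add_mult_distrib)
  ultimately show "\<exists>j\<le>N. (a, b) = exps j"
    using a b by (auto simp: exps_def)
next
  assume "\<exists>j\<le>N. (a, b) = exps j"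
  then obtain j where "j \<le> N" "a = s + (N - j) * u1" "b = r + j * u0"
    by (auto simp: exps_def)
  moreover obtain k where "N = j + k" using \<open>j \<le> N\<close> le_Suc_ex by blast
  ultimately show "w0 * a + w1 * b = d" by (simp add: algebra_simps)
qed

lemma keys_subset_exps: "f \<in> wpoly w0 w1 d \<Longrightarrow> Poly_Mapping.keys f \<subseteq> exps ` {..N}"
proof
  fix m assume f: "f \<in> wpoly w0 w1 d" and "m \<in> Poly_Mapping.keys f"
  hence "w0 * fst m + w1 * snd m = d" by (rule keys_wpoly)
  thus "m \<in> exps ` {..N}" using weighted_degree_eq_iff by fastforce
qed

text \<open>The coordinate of the dehomogenisation is \<open>x\<^sub>1 ^ u0 / x\<^sub>0 ^ u1\<close>.\<close>

definition dehom :: "(nat \<times> nat \<Rightarrow>\<^sub>0 'a) \<Rightarrow> 'a :: field poly" where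
  "dehom f = (\<Sum>j\<le>N. Polynomial.monom (Poly_Mapping.lookup f (exps j)) j)"

lemma coeff_dehom:
  "poly.coeff (dehom f) j = (if j \<le> N then Poly_Mapping.lookup f (exps j) else 0)"
  by (simp add: dehom_def coeff_sum)

lemma degree_dehom: "degree (dehom f) \<le> N"
  by (rule degree_le) (simp add: coeff_dehom)

lemma dehom_nonzero:
  assumes "f \<in> wpoly w0 w1 d" "f \<noteq> 0"
  shows "dehom f \<noteq> 0"
proof -
  obtain m where m: "m \<in> Poly_Mapping.keys f" using assms(2) by (metis all_not_in_conv keys_eq_empty)
  with keys_subset_exps[OF assms(1)] obtain j where "j \<le> N" "m = exps j" by auto
  with m have "poly.coeff (dehom f) j \<noteq> 0" by (simp add: coeff_dehom in_keys_iff)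
  thus ?thesis by auto
qed

lemma dehom_surj:
  fixes h :: "'a :: field poly"
  assumes "degree h \<le> N"
  obtains f where "f \<in> wpoly w0 w1 d" "dehom f = h"
proof
  define f where "f = (\<Sum>j\<le>N. poly_scale (poly.coeff h j) (Poly_Mapping.single (exps j) 1))"
  show "f \<in> wpoly w0 w1 d"
    unfolding f_def wpoly_def
  proof (intro poly_space.span_sum poly_space.span_scale poly_space.span_base)
    fix j assume "j \<in> {..N}"
    hence "w0 * fst (exps j) + w1 * snd (exps j) = d"
      by (subst weighted_degree_eq_iff) auto
    thus "Poly_Mapping.single (exps j) 1 \<in>
        {Poly_Mapping.single (a0, a1) 1 |a0 a1. w0 * a0 + w1 * a1 = d}"
      by (metis (mono_tags, lifting) mem_Collect_eq prod.collapse)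
  qed
  have "Poly_Mapping.lookup f (exps i) = (if i \<le> N then poly.coeff h i else 0)" for i
    unfolding f_def
    by (simp add: lookup_sum lookup_poly_scale lookup_single when_def inj_eq[OF inj_exps]
        if_distrib[of "(*) _"] cong: if_cong)
  thus "dehom f = h"
    using assms by (auto simp: poly_eq_iff coeff_dehom coeff_eq_0)
qed

text \<open>At \<open>(1, y)\<close> the monomial with exponents \<open>exps j\<close> takes the
  value \<open>y^r (y^u0)^j\<close>, so only the invariant \<open>t\<close> enters apart from the
  factor \<open>y^r\<close>.\<close>

lemma eval2_affine:
  assumes "f \<in> wpoly w0 w1 d" "y ^ u0 = to_ac t"
  shows "eval2 f (1, y) = y ^ r * to_ac (poly (dehom f) t)"
proof -
  have "eval2 f (1, y) = (\<Sum>j\<le>N. to_ac (Poly_Mapping.lookup f (exps j)) * y ^ (r + j * u0))"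
    unfolding eval2_superset[OF finite_imageI[OF finite_atMost] keys_subset_exps[OF assms(1)]]
    by (subst sum.reindex) (auto intro: inj_on_subset[OF inj_exps] simp: exps_def)
  also have "\<dots> = y ^ r * (\<Sum>j\<le>N. to_ac (Poly_Mapping.lookup f (exps j) * t ^ j))"
    unfolding sum_distrib_left
  proof (intro sum.cong refl)
    fix j
    have "y ^ (j * u0) = to_ac t ^ j" by (metis assms(2) mult.commute power_mult)
    thus "to_ac (Poly_Mapping.lookup f (exps j)) * y ^ (r + j * u0) =
        y ^ r * to_ac (Poly_Mapping.lookup f (exps j) * t ^ j)"
      by (simp add: power_add)
  qed
  also have "(\<Sum>j\<le>N. to_ac (Poly_Mapping.lookup f (exps j) * t ^ j)) = to_ac (poly (dehom f) t)"
    by (simp add: dehom_def poly_sum poly_monom to_ac_sum)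
  finally show ?thesis .
qed

text \<open>At \<open>x0 = 0\<close> only a monomial free of \<open>x0\<close> survives, which
  requires \<open>s = 0\<close> and \<open>j = N\<close>.\<close>

lemma eval2_infinity:
  assumes "f \<in> wpoly w0 w1 d"
  shows "eval2 f (0, 1) = (if s > 0 then 0 else to_ac (poly.coeff (dehom f) N))"
proof -
  have top: "poly.coeff (dehom f) N = Poly_Mapping.lookup f (exps N)"
    by (simp add: coeff_dehom)
  have "eval2 f (0, 1) =
      (\<Sum>j\<le>N. to_ac (Poly_Mapping.lookup f (exps j)) * 0 ^ (s + (N - j) * u1))"
    unfolding eval2_superset[OF finite_imageI[OF finite_atMost] keys_subset_exps[OF assms(1)]]
    by (subst sum.reindex) (auto intro: inj_on_subset[OF inj_exps] simp: exps_def)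
  also have "\<dots> = (\<Sum>j\<le>N. if j = N then (if s > 0 then 0 else to_ac (poly.coeff (dehom f) N)) else 0)"
    unfolding top using u1 by (intro sum.cong refl) (simp add: power_0_left)
  finally show ?thesis by simp
qed

section \<open>Rational points of the weighted projective line\<close>

lemma wproj_rel_infinity:
  fixes y :: "'a :: field alg_closure"
  assumes "y \<noteq> 0"
  shows "((0, 1), (0, y)) \<in> wproj_rel w0 w1"
proof -
  obtain l where "l ^ w1 = y" using nth_root_exists[of w1 y] g u1 by auto
  thus ?thesis using assms g u0 u1
    by (auto simp: wproj_rel_def punctured_plane_def wscale_def intro!: exI[of _ l])
qed

text \<open>A scaling between the two points must satisfy \<open>l^w0 = 1\<close>, which leaves
  \<open>y^u0\<close> unchanged. Conversely, \<open>b = z / y\<close> is a \<open>u0\<close>-th root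
  of unity, and coprimality allows it to be written as \<open>l^w1\<close> with
  \<open>l^w0 = 1\<close>.\<close>

lemma wproj_rel_affine_iff:
  fixes y z :: "'a :: field alg_closure"
  shows "((1, y), (1, z)) \<in> wproj_rel w0 w1 \<longleftrightarrow> y ^ u0 = z ^ u0"
proof
  assume "((1, y), (1, z)) \<in> wproj_rel w0 w1"
  then obtain l where l: "l ^ w0 = 1" "z = l ^ w1 * y"
    by (auto simp: wproj_rel_def wscale_def)
  have "z ^ u0 = (l ^ w0) ^ u1 * y ^ u0"
    unfolding l(2) by (simp add: power_mult_distrib mult_ac flip: power_mult)
  thus "y ^ u0 = z ^ u0" by (simp add: l(1))
next
  assume eq: "y ^ u0 = z ^ u0"
  show "((1, y), (1, z)) \<in> wproj_rel w0 w1"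
  proof (cases "y = 0")
    case True
    hence "z = 0" using eq u0 by (metis power_eq_0_iff zero_power)
    with True show ?thesis
      by (auto simp: wproj_rel_def punctured_plane_def wscale_def intro!: exI[of _ 1])
  next
    case False
    define b where "b = z / y"
    have b: "b ^ u0 = 1" "z = b * y"
      using False by (simp_all add: b_def power_divide flip: eq)
    \<comment> \<open>With \<open>k\<close> inverse to \<open>u1\<close> modulo \<open>u0\<close>
      and \<open>l^g = b^k\<close>, one gets \<open>l^w0 = b^(k u0) = 1\<close> and
      \<open>l^w1 = b^(k u1) = b\<close>.\<close>
    obtain k where k: "[u1 * k = Suc 0] (mod u0)"
      using cong_solve_coprime_nat coprime coprime_commute by blast
    have red: "b ^ n = b ^ (n mod u0)" for n
    proof -
      have "b ^ n = b ^ (u0 * (n div u0) + n mod u0)" by simp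
      thus ?thesis by (simp only: power_add power_mult b(1)) simp
    qed
    have "b ^ (u1 * k) = b"
      using red[of "u1 * k"] red[of "Suc 0"] k by (simp add: cong_def)
    obtain l where l: "l ^ g = b ^ k" using nth_root_exists[OF g] by blast
    have "b \<noteq> 0" using b(1) u0 by (metis power_0_left less_not_refl zero_neq_one)
    hence "l \<noteq> 0" using l g by (metis power_eq_0_iff zero_power)
    moreover have "l ^ w0 = 1"
      by (simp add: power_mult l) (metis b(1) mult.commute power_mult power_one)
    moreover have "l ^ w1 = b"
      using \<open>b ^ (u1 * k) = b\<close> by (simp add: power_mult l) (metis mult.commute power_mult)
    ultimately show ?thesis using b(2)
      by (auto simp: wproj_rel_def punctured_plane_def wscale_def intro!: exI[of _ l])
  qed
qed

lemma wproj_rel_normalize: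
  fixes x :: "'a :: field alg_closure \<times> 'a alg_closure"
  assumes "fst x \<noteq> 0"
  shows "\<exists>y. (x, (1, y)) \<in> wproj_rel w0 w1"
proof -
  obtain l where l: "l ^ w0 = inverse (fst x)" using nth_root_exists[of w0] g u0 by force
  hence "l \<noteq> 0" using assms g u0 by (auto simp: power_0_left)
  thus ?thesis using assms l
    by (auto simp: wproj_rel_def punctured_plane_def wscale_def prod_eq_iff
        intro!: exI[of _ "l ^ w1 * snd x"] exI[of _ l])
qed

text \<open>Any root serves: by \<open>wproj_rel_affine_iff\<close> all of them give the same
  orbit.\<close>

definition wroot :: "'a :: field \<Rightarrow> 'a alg_closure" where
  "wroot t = (SOME y. y ^ u0 = to_ac t)"

lemma wroot: "wroot t ^ u0 = to_ac t"
  unfolding wroot_def using nth_root_exists[OF u0] by (rule someI_ex)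

text \<open>The option type models the projective line over the finite field: \<open>None\<close> is
  the point at infinity \<open>x0 = 0\<close>, and \<open>Some t\<close> is the point with invariant
  \<open>t\<close>.\<close>

fun wrep :: "'a :: field option \<Rightarrow> 'a alg_closure \<times> 'a alg_closure" where
  "wrep None = (0, 1)"
| "wrep (Some t) = (1, wroot t)"

definition wpoint :: "'a :: field option \<Rightarrow> ('a alg_closure \<times> 'a alg_closure) set" where
  "wpoint p = wproj_rel w0 w1 `` {wrep p}"

lemma wrep_punctured: "wrep p \<in> punctured_plane"
  by (cases p) (auto simp: punctured_plane_def)

lemma not_wproj_rel_infinity:
  "((0, y), (1, z)) \<notin> wproj_rel w0 w1" "((1, z), (0, y)) \<notin> wproj_rel w0 w1"
  using g u0 by (auto simp: wproj_rel_def wscale_def)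

lemma inj_wpoint: "inj (wpoint :: 'a :: field option \<Rightarrow> _)"
proof (rule injI)
  fix p p' :: "'a option"
  assume "wpoint p = wpoint p'"
  hence "(wrep p, wrep p') \<in> wproj_rel w0 w1"
    unfolding wpoint_def
    by (rule eq_equiv_class[OF _ equiv_wproj_rel wrep_punctured])
  thus "p = p'"
    by (cases p; cases p') (auto simp: not_wproj_rel_infinity wproj_rel_affine_iff wroot)
qed

text \<open>The orbit of \<open>(1, y)\<close> is Frobenius-stable iff \<open>y^u0\<close> is fixed
  by the \<open>q\<close>-th power map, that is, iff it lies in the finite field. The orbit at
  infinity is always stable.\<close>

lemma wproj_rational_points_eq:
  "wproj_rational_points w0 w1 = range (wpoint :: 'a :: {field, finite} option \<Rightarrow> _)"
proof (intro equalityI subsetI)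
  fix P assume "P \<in> range (wpoint :: 'a option \<Rightarrow> _)"
  then obtain p :: "'a option" where P: "P = wpoint p" by blast
  have "(wrep p, frob (wrep p)) \<in> wproj_rel w0 w1"
  proof (cases p)
    case None
    thus ?thesis by (simp add: frob_def zero_power wproj_rel_infinity)
  next
    case (Some t)
    have "(wroot t ^ CARD('a)) ^ u0 = (wroot t ^ u0) ^ CARD('a)"
      by (simp add: mult.commute flip: power_mult)
    also have "\<dots> = wroot t ^ u0"
      by (simp add: wroot power_CARD_eq_self flip: to_ac_power)
    finally show ?thesis by (simp add: Some frob_def wproj_rel_affine_iff)
  qed
  hence "frob ` P = P"
    unfolding P wpoint_def frob_image_orbit[OF wrep_punctured]
    using equiv_class_eq[OF equiv_wproj_rel] by metis
  thus "P \<in> wproj_rational_points w0 w1"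
    by (simp add: wproj_rational_points_def wproj_line_def P wpoint_def wrep_punctured quotientI)
next
  fix P :: "('a alg_closure \<times> 'a alg_closure) set"
  assume "P \<in> wproj_rational_points w0 w1"
  then obtain x where x: "x \<in> punctured_plane" "P = wproj_rel w0 w1 `` {x}" and P: "frob ` P = P"
    by (auto simp: wproj_rational_points_def wproj_line_def elim!: quotientE)
  show "P \<in> range wpoint"
  proof (cases "fst x = 0")
    case True
    with x(1) have "x = (0, snd x)" "snd x \<noteq> 0"
      by (auto simp: punctured_plane_def prod_eq_iff)
    hence "(wrep None, x) \<in> wproj_rel w0 w1"
      using wproj_rel_infinity[of "snd x"] by (metis wrep.simps(1))
    hence "P = wpoint None"
      unfolding x(2) wpoint_def by (rule equiv_class_eq[OF equiv_wproj_rel, symmetric])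
    thus ?thesis by blast
  next
    case False
    then obtain y where "(x, (1, y)) \<in> wproj_rel w0 w1" using wproj_rel_normalize by blast
    hence Py: "P = wproj_rel w0 w1 `` {(1, y)}"
      unfolding x(2) by (rule equiv_class_eq[OF equiv_wproj_rel])
    have yp: "(1, y) \<in> punctured_plane" by (simp add: punctured_plane_def)
    have "wproj_rel w0 w1 `` {frob (1, y)} = wproj_rel w0 w1 `` {(1, y)}"
      using P unfolding Py frob_image_orbit[OF yp] .
    hence "(frob (1, y), (1, y)) \<in> wproj_rel w0 w1"
      by (rule eq_equiv_class[OF _ equiv_wproj_rel yp])
    hence "(y ^ CARD('a)) ^ u0 = y ^ u0" by (simp add: frob_def wproj_rel_affine_iff)
    hence "(y ^ u0) ^ CARD('a) = y ^ u0" by (simp add: mult.commute flip: power_mult)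
    then obtain t where "y ^ u0 = to_ac t" using range_to_ac_iff by blast
    hence "((1, y), wrep (Some t)) \<in> wproj_rel w0 w1"
      by (simp add: wproj_rel_affine_iff wroot)
    hence "P = wpoint (Some t)"
      unfolding Py wpoint_def by (rule equiv_class_eq[OF equiv_wproj_rel])
    thus ?thesis by blast
  qed
qed

section \<open>Counting zeros and attaining the bound\<close>

text \<open>The extra zero at \<open>t = 0\<close> comes from the factor
  \<open>x1^r\<close>.\<close>

definition affine_zeros :: "'a :: field poly \<Rightarrow> 'a set" where
  "affine_zeros h = {t. poly h t = 0 \<or> (t = 0 \<and> r > 0)}"

lemma eval2_wrep_eq_0_iff:
  assumes "f \<in> wpoly w0 w1 d"
  shows "eval2 f (wrep p) = 0 \<longleftrightarrow>
    (case p of None \<Rightarrow> s > 0 \<or> poly.coeff (dehom f) N = 0 | Some t \<Rightarrow> t \<in> affine_zeros (dehom f))"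
proof (cases p)
  case None
  thus ?thesis by (simp add: eval2_infinity[OF assms])
next
  case (Some t)
  have "wroot t = 0 \<longleftrightarrow> t = 0" using wroot[of t] u0 by (metis power_eq_0_iff to_ac_eq_0_iff)
  thus ?thesis by (auto simp: Some eval2_affine[OF assms wroot] affine_zeros_def)
qed

text \<open>Homogeneity reduces vanishing on an orbit to vanishing at \<open>wrep p\<close>, and
  \<open>wpoint\<close> is a bijection onto the rational points. The \<open>of_bool\<close> term
  counts the point at infinity.\<close>

lemma card_wzeros:
  fixes f :: "nat \<times> nat \<Rightarrow>\<^sub>0 'a :: {field, finite}"
  assumes "f \<in> wpoly w0 w1 d"
  shows "card (wzeros w0 w1 f) =
    card (affine_zeros (dehom f)) + of_bool (s > 0 \<or> poly.coeff (dehom f) N = 0)"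
proof -
  have vanish: "(\<forall>x\<in>wpoint p. eval2 f x = 0) \<longleftrightarrow> eval2 f (wrep p) = 0" for p
  proof -
    have "wrep p \<in> wpoint p"
      unfolding wpoint_def by (rule equiv_class_self[OF equiv_wproj_rel wrep_punctured])
    moreover have "eval2 f x = 0" if "x \<in> wpoint p" "eval2 f (wrep p) = 0" for x
    proof -
      have "\<exists>l. x = wscale w0 w1 l (wrep p)"
        using that(1) by (auto simp: wpoint_def wproj_rel_def)
      thus ?thesis using that(2) by (auto simp only: eval2_wscale[OF assms] mult_zero_right)
    qed
    ultimately show ?thesis by blast
  qed
  define Z where "Z = {p. eval2 f (wrep p) = 0}"
  have "wzeros w0 w1 f = wpoint ` Z"
    unfolding wzeros_def wproj_rational_points_eq using vanish by (auto simp: Z_def)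
  hence "card (wzeros w0 w1 f) = card Z"
    by (simp add: card_image inj_on_subset[OF inj_wpoint])
  also have "Z = Some ` affine_zeros (dehom f) \<union>
      (if s > 0 \<or> poly.coeff (dehom f) N = 0 then {None} else {})"
    unfolding Z_def set_eq_iff eval2_wrep_eq_0_iff[OF assms] mem_Collect_eq
    by (auto split: option.split)
  also have "card \<dots> = card (affine_zeros (dehom f)) +
      of_bool (s > 0 \<or> poly.coeff (dehom f) N = 0)"
    by (subst card_Un_disjoint) (auto simp: card_image)
  finally show ?thesis .
qed

lemma card_wzeros_le:
  fixes f :: "nat \<times> nat \<Rightarrow>\<^sub>0 'a :: {field, finite}"
  assumes "f \<in> wpoly w0 w1 d" "f \<noteq> 0"
  shows "card (wzeros w0 w1 f) \<le> min (CARD('a) + 1) (N + of_bool (s > 0) + of_bool (r > 0))"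
proof -
  let ?h = "dehom f"
  have h: "?h \<noteq> 0" using dehom_nonzero[OF assms] .
  have "card (affine_zeros ?h) \<le> CARD('a)" by (intro card_mono) auto
  hence "card (wzeros w0 w1 f) \<le> CARD('a) + 1"
    unfolding card_wzeros[OF assms(1)] by (rule add_mono) simp
  moreover have "card (affine_zeros ?h) \<le> degree ?h + of_bool (r > 0)"
  proof -
    have "affine_zeros ?h = {t. poly ?h t = 0} \<union> (if r > 0 then {0} else {})"
      by (auto simp: affine_zeros_def)
    also have "card \<dots> \<le> card {t. poly ?h t = 0} + of_bool (r > 0)"
      by (rule order.trans[OF card_Un_le]) auto
    finally show ?thesis using card_poly_roots_bound[OF h] by simp
  qed
  \<comment> \<open>If the top coefficient vanishes, the degree drops below \<open>N\<close>, which
    pays for the zero at infinity.\<close>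
  moreover have "degree ?h + of_bool (s > 0 \<or> poly.coeff ?h N = 0) \<le> N + of_bool (s > 0)"
  proof (cases "poly.coeff ?h N = 0")
    case True
    hence "degree ?h \<noteq> N" using h by (metis leading_coeff_0_iff)
    hence "degree ?h + 1 \<le> N" using degree_dehom[of f] by linarith
    moreover have "of_bool (s > 0 \<or> poly.coeff ?h N = 0) \<le> (1 :: nat)" by simp
    ultimately show ?thesis by linarith
  next
    case False
    hence "(s > 0 \<or> poly.coeff ?h N = 0) \<longleftrightarrow> s > 0" by blast
    thus ?thesis using degree_dehom[of f] by simp
  qed
  ultimately show ?thesis
    unfolding card_wzeros[OF assms(1)] by (intro min.boundedI) linarith+
qed

text \<open>A product of distinct linear factors is used, with as many of its \<open>N\<close>
  available roots as fit. If the field has too few candidates, the degree stays below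
  \<open>N\<close> and infinity becomes a zero as well, so all \<open>q + 1\<close> points are
  zeros.\<close>

lemma card_wzeros_attained:
  obtains f :: "nat \<times> nat \<Rightarrow>\<^sub>0 'a :: {field, finite}"
  where "f \<in> wpoly w0 w1 d" "f \<noteq> 0"
    "card (wzeros w0 w1 f) \<ge> min (CARD('a) + 1) (N + of_bool (s > 0) + of_bool (r > 0))"
proof -
  \<comment> \<open>The root \<open>0\<close> is excluded when \<open>x1^r\<close> already vanishes
    there, so that no zero is counted twice.\<close>
  define A where "A = (if r > 0 then UNIV - {0 :: 'a} else UNIV)"
  have cA: "card A + of_bool (r > 0) = CARD('a)"
    using card_Suc_Diff1[of UNIV "0 :: 'a"] by (auto simp: A_def)
  obtain T where T: "T \<subseteq> A" "card T = min N (card A)"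
    using obtain_subset_with_card_n[of "min N (card A)" A] by auto
  define h where "h = (\<Prod>t\<in>T. [:- t, 1:])"
  have h: "h \<noteq> 0" "degree h = card T"
    by (simp_all add: h_def degree_prod_eq_sum_degree)
  obtain f where f: "f \<in> wpoly w0 w1 d" "dehom f = h" using dehom_surj[of h] h T by auto
  have "f \<noteq> 0" using f(2) h(1) by (auto simp: dehom_def)
  have "card T + of_bool (r > 0) \<le> card (affine_zeros h)"
  proof -
    have "T \<union> (if r > 0 then {0} else {}) \<subseteq> affine_zeros h"
      by (auto simp: affine_zeros_def h_def poly_prod)
    hence "card (T \<union> (if r > 0 then {0} else {})) \<le> card (affine_zeros h)"
      by (intro card_mono) auto
    moreover have "card (T \<union> (if r > 0 then {0} else {})) = card T + of_bool (r > 0)"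
      using T(1) by (subst card_Un_disjoint) (auto simp: A_def)
    ultimately show ?thesis by simp
  qed
  moreover have "poly.coeff h N = 0" if "card T < N"
    using that h(2) by (simp add: coeff_eq_0)
  ultimately have "card (wzeros w0 w1 f) \<ge>
      min (CARD('a) + 1) (N + of_bool (s > 0) + of_bool (r > 0))"
    using T(2) cA unfolding card_wzeros[OF f(1)] f(2) by (cases "N \<le> card A") auto
  thus ?thesis using that f(1) \<open>f \<noteq> 0\<close> by blast
qed

lemma max_wzeros_eq:
  "max_wzeros TYPE('a :: {field, finite}) d w0 w1 =
    min (CARD('a) + 1) (N + of_bool (s > 0) + of_bool (r > 0))"
  unfolding max_wzeros_def
proof (rule Max_eqI)
  have "w0 > 0" "w1 > 0" using g u0 u1 by auto
  from finite_wpoly[OF this]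
  show "finite {card (wzeros w0 w1 f) |f :: nat \<times> nat \<Rightarrow>\<^sub>0 'a. f \<in> wpoly w0 w1 d \<and> f \<noteq> 0}"
    by (rule finite_surj[where f = "\<lambda>f. card (wzeros w0 w1 f)"]) auto
  show "n \<le> min (CARD('a) + 1) (N + of_bool (s > 0) + of_bool (r > 0))"
    if "n \<in> {card (wzeros w0 w1 f) |f :: nat \<times> nat \<Rightarrow>\<^sub>0 'a. f \<in> wpoly w0 w1 d \<and> f \<noteq> 0}" for n
    using that card_wzeros_le by blast
  show "min (CARD('a) + 1) (N + of_bool (s > 0) + of_bool (r > 0)) \<in>
      {card (wzeros w0 w1 f) |f :: nat \<times> nat \<Rightarrow>\<^sub>0 'a. f \<in> wpoly w0 w1 d \<and> f \<noteq> 0}"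
  proof -
    obtain f :: "nat \<times> nat \<Rightarrow>\<^sub>0 'a" where f: "f \<in> wpoly w0 w1 d" "f \<noteq> 0"
      "card (wzeros w0 w1 f) \<ge> min (CARD('a) + 1) (N + of_bool (s > 0) + of_bool (r > 0))"
      by (rule card_wzeros_attained)
    from antisym[OF f(3) card_wzeros_le[OF f(1,2)]] f(1,2) show ?thesis by blast
  qed
qed

section \<open>Divisibility, division by the lcm, and the denumerant\<close>

text \<open>Modulo \<open>w0\<close> only \<open>w1 * r\<close> remains; \<open>u1\<close> is
  coprime to \<open>u0\<close>, and \<open>r < u0\<close>.\<close>

lemma w0_dvd_iff: "w0 dvd d \<longleftrightarrow> r = 0"
proof -
  have "w0 dvd d \<longleftrightarrow> g * u0 dvd g * (u1 * r + u0 * (s + N * u1))"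
    by (simp add: algebra_simps)
  also have "\<dots> \<longleftrightarrow> u0 dvd u1 * r"
    using g by (simp add: nat_mult_dvd_cancel_disj dvd_add_left_iff)
  also have "\<dots> \<longleftrightarrow> u0 dvd r" using coprime by (rule coprime_dvd_mult_right_iff)
  also have "\<dots> \<longleftrightarrow> r = 0" using r by (auto dest: dvd_imp_le)
  finally show ?thesis .
qed

lemma w1_dvd_iff: "w1 dvd d \<longleftrightarrow> s = 0"
proof -
  have "w1 dvd d \<longleftrightarrow> g * u1 dvd g * (u0 * s + u1 * (r + N * u0))"
    by (simp add: algebra_simps)
  also have "\<dots> \<longleftrightarrow> u1 dvd u0 * s"
    using g by (simp add: nat_mult_dvd_cancel_disj dvd_add_left_iff)
  also have "\<dots> \<longleftrightarrow> u1 dvd s"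
    using coprime by (simp add: coprime_dvd_mult_right_iff coprime_commute)
  also have "\<dots> \<longleftrightarrow> s = 0" using s by (auto dest: dvd_imp_le)
  finally show ?thesis .
qed

lemma lcm_eq: "lcm w0 w1 = g * u0 * u1"
  using coprime by (simp add: lcm_mult_left lcm_coprime mult.assoc)

lemma residual_less: "w0 * s < g * u0 * u1" "w1 * r < g * u0 * u1"
  using s r g u0 u1 by (simp_all add: mult.commute[of u0 u1])

text \<open>Each residual term is below the lcm, so their sum carries at most once.\<close>

lemma div_lcm_eq:
  "d div (g * u0 * u1) = N + (if w0 * s + w1 * r < g * u0 * u1 then 0 else 1)"
proof -
  have "w0 * s + w1 * r < g * u0 * u1 + g * u0 * u1"
    using residual_less by (rule add_strict_mono)
  hence "(w0 * s + w1 * r) div (g * u0 * u1) = (if w0 * s + w1 * r < g * u0 * u1 then 0 else 1)"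
    by (auto simp: div_nat_eqI)
  thus ?thesis using g u0 u1 by simp
qed

text \<open>Both facts follow from the classification of exponents with \<open>N = 0\<close>, where
  \<open>(s, r)\<close> is the only solution.\<close>

lemma den_residual:
  "den (w0 * s + w1 * r) w0 w1 = 1"
  "w0 * s + w1 * r = g * u0 * u1 + n \<Longrightarrow> den n w0 w1 = 0"
proof -
  interpret R: weighted_degree g u0 u1 s r 0
    by unfold_locales (fact g u0 u1 coprime s r)+
  have sol: "w0 * a + w1 * b = w0 * s + w1 * r \<longleftrightarrow> a = s \<and> b = r" for a b
    using R.weighted_degree_eq_iff[of a b] by (simp add: R.exps_def)
  show "den (w0 * s + w1 * r) w0 w1 = 1"
    by (simp add: den_def sol)
  assume n: "w0 * s + w1 * r = g * u0 * u1 + n"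
  have False if "w0 * a + w1 * b = n" for a b
  proof -
    \<comment> \<open>A solution for \<open>n\<close>, shifted by one lcm, would have first exponent
      at least \<open>u1 > s\<close>.\<close>
    have "w0 * (a + u1) + w1 * b = w0 * s + w1 * r"
      unfolding n that[symmetric] by (simp add: algebra_simps)
    thus False using sol s by simp
  qed
  hence "{(a, b). w0 * a + w1 * b = n} = {}" by auto
  thus "den n w0 w1 = 0" by (simp add: den_def)
qed

text \<open>A carry raises the quotient by one and lowers the denumerant of the remainder from 1 to
  0, so the sum is the same either way.\<close>

lemma div_plus_den_mod:
  "d div (g * u0 * u1) + den (d mod (g * u0 * u1)) w0 w1 = N + 1"
proof (cases "w0 * s + w1 * r < g * u0 * u1")
  case True
  thus ?thesis using div_lcm_eq den_residual(1) by simp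
next
  case False
  then obtain n where n: "w0 * s + w1 * r = g * u0 * u1 + n"
    using le_Suc_ex not_less by blast
  have "d div (g * u0 * u1) = N + 1" using False div_lcm_eq by simp
  moreover from this have "d mod (g * u0 * u1) = d - (N + 1) * (g * u0 * u1)"
    by (metis minus_div_mult_eq_mod)
  hence "d mod (g * u0 * u1) = n" unfolding n by simp
  ultimately show ?thesis using den_residual(2)[OF n] by simp
qed

lemma div_lcm_eq_of_dvd:
  assumes "r = 0 \<or> s = 0"
  shows "d div (g * u0 * u1) = N"
  using assms residual_less div_lcm_eq by auto

end

section \<open>Existence of the decomposition and the final formula\<close>

lemma weighted_degree_decomposition:
  fixes w0 w1 n :: nat
  assumes "w0 > 0" "w1 > 0" "n \<in> num_semigroup w0 w1"
  obtains g u0 u1 s r N where "weighted_degree g u0 u1 s r" "w0 = g * u0" "w1 = g * u1"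
    "n = w0 * s + w1 * r + N * (g * u0 * u1)"
proof -
  obtain i0 i1 where n: "n = w0 * i0 + w1 * i1" using assms(3) by (auto simp: num_semigroup_def)
  define g where "g = gcd w0 w1"
  have g: "g > 0" using assms by (simp add: g_def)
  obtain u0 u1 where w: "w0 = g * u0" "w1 = g * u1" and coprime: "coprime u0 u1"
    using gcd_coprime_exists[of w0 w1] g unfolding g_def by (metis mult.commute not_gr_zero)
  have u: "u0 > 0" "u1 > 0" using assms w by auto
  \<comment> \<open>Since \<open>w1 * u0 = w0 * u1\<close>, each full block of \<open>u0\<close> in
    \<open>i1\<close> can be traded for \<open>u1\<close> in the exponent of
    \<open>x0\<close>.\<close>
  define A where "A = i0 + u1 * (i1 div u0)"
  have "weighted_degree g u0 u1 (A mod u1) (i1 mod u0)"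
    using g u coprime by unfold_locales auto
  moreover have "n = w0 * (A mod u1) + w1 * (i1 mod u0) + (A div u1) * (g * u0 * u1)"
  proof -
    have shift: "w0 * (a + u1 * k) + w1 * b = w0 * a + w1 * (b + u0 * k)" for a b k
      unfolding w by (simp add: algebra_simps)
    have "n = w0 * A + w1 * (i1 mod u0)"
      unfolding n A_def shift by simp
    also have "w0 * A = w0 * (A mod u1 + u1 * (A div u1))" by simp
    also have "\<dots> = w0 * (A mod u1) + (A div u1) * (g * u0 * u1)"
      unfolding w by (simp only: distrib_left mult_ac)
    finally show ?thesis by simp
  qed
  ultimately show ?thesis using that w by blast
qed

theorem corollary4p3:
  fixes w0 w1 d lam rho :: nat
  assumes "w0 > 0" and "w1 > 0"
    and "d \<in> num_semigroup w0 w1"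
    and "d = lam * lcm w0 w1 + rho" and "rho < lcm w0 w1"
  shows "max_wzeros TYPE('a :: {field, finite}) d w0 w1 =
    min (CARD('a) + 1)
      (if lcm w0 w1 dvd d then lam
       else if (w0 dvd d) \<noteq> (w1 dvd d) then lam + 1
       else lam + 1 + den rho w0 w1)"
proof -
  obtain g u0 u1 s r N where W: "weighted_degree g u0 u1 s r"
    and w: "w0 = g * u0" "w1 = g * u1" and d: "d = w0 * s + w1 * r + N * (g * u0 * u1)"
    using weighted_degree_decomposition[OF assms(1-3)] by blast
  \<comment> \<open>No locale assumption constrains \<open>N\<close>, so the predicate omits it and
    it is supplied here.\<close>
  interpret W: weighted_degree g u0 u1 s r N by (fact W)
  have dvd: "w0 dvd d \<longleftrightarrow> r = 0" "w1 dvd d \<longleftrightarrow> s = 0"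
    using W.w0_dvd_iff W.w1_dvd_iff by (simp_all add: d w)
  have lcm: "lcm w0 w1 dvd d \<longleftrightarrow> r = 0 \<and> s = 0"
    by (simp add: dvd)
  have lam: "lam = d div (g * u0 * u1)" and rho: "rho = d mod (g * u0 * u1)"
  proof -
    have "d = rho + lam * (g * u0 * u1)" "rho < g * u0 * u1"
      using assms(4,5) unfolding w W.lcm_eq by simp_all
    thus "lam = d div (g * u0 * u1)" "rho = d mod (g * u0 * u1)"
      by (simp_all only: div_mult_self1 mod_mult_self1 div_less mod_less add_0_right not_less_zero
          simp_thms neq0_conv)
  qed
  have max: "max_wzeros TYPE('a) d w0 w1 =
      min (CARD('a) + 1) (N + of_bool (s > 0) + of_bool (r > 0))"
    unfolding d w by (rule W.max_wzeros_eq)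
  have one: "lam = N" if "r = 0 \<or> s = 0"
    using W.div_lcm_eq_of_dvd[OF that] by (simp add: lam d w)
  \<comment> \<open>For \<open>r\<close> and \<open>s\<close> both positive this turns
    \<open>N + 2\<close> into \<open>lam + 1 + den rho w0 w1\<close>.\<close>
  have two: "lam + den rho w0 w1 = N + 1"
    using W.div_plus_den_mod by (simp add: lam rho d w)
  show ?thesis
  proof (cases "r = 0 \<or> s = 0")
    case True
    thus ?thesis using one[OF True] by (auto simp: max lcm dvd)
  next
    case False
    thus ?thesis using two by (simp add: max lcm dvd)
  qed
qed

end
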